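(* Let $\mu$ be a partition with $\mu_1\le n$, let $\widetilde\mu$ be its conjugate, and let $1\le k\le n$. Then $$e^*_k(\widetilde\mu)=\sum hstrip_\mu(k)!,$$ where the sum is extended over all horizontal strips of length $k$ in the Ferrers diagram of $\mu$, and $hstrip_\mu(k)!$ denotes the product of the factorials of the cardinalities of the horizontal components of the horizontal strip.
   Context: Here $e^*_k(\widetilde\mu)=\sum_{1\le i_1<i_2<\cdots<i_k\le n}(\widetilde\mu_{i_1}+k-1)(\widetilde\mu_{i_2}+k-2)\cdots(\widetilde\mu_{i_k})$, with $\widetilde\mu_i=0$ for $i>\mu_1$. (This integer is the eigenvalue of the Capelli element $\mathbf H_k(n)=\sum_{i_1<\cdots<i_k}\mathbf{cdet}[e_{i_r,i_s}+\delta_{rs}(k-s)]_{r,s=1}^k$ of $\mathbf U(gl(n))$ on the irreducible $gl(n)$-module of highest weight $\widetilde\mu$, where $\mathbf{cdet}(A)=\sum_\sigma(-1)^{|\sigma|}a_{\sigma(1),1}\cdots a_{\sigma(k),k}$.) In generalized sense, a horizontal strip of length $k$ in a Ferrers diagram is a subset of $k$ cells such that no two cells of the subset lie in the same column; its horizontal components are the sets of all its cells lying in the same row. *)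

theory Defs
  imports Main
begin

text \<open>
  A partition is a weakly decreasing sequence of natural numbers with only finitely many nonzero
  terms. All indices (of parts, rows and columns) start at 1; the values at index 0 of a
  sequence and of its conjugate are never used.
\<close>

definition is_partition :: "(nat \<Rightarrow> nat) \<Rightarrow> bool" where
  "is_partition \<mu> \<longleftrightarrow>
     (\<forall>i j. 1 \<le> i \<and> i \<le> j \<longrightarrow> \<mu> j \<le> \<mu> i) \<and> finite {i. 1 \<le> i \<and> \<mu> i \<noteq> 0}"

text \<open>Cells are pairs (row, column).\<close>

definition ferrers :: "(nat \<Rightarrow> nat) \<Rightarrow> (nat \<times> nat) set" where
  "ferrers \<mu> = {(i, j). 1 \<le> i \<and> 1 \<le> j \<and> j \<le> \<mu> i}"

text \<open>
  The \<open>j\<close>-th part of the conjugate is the length of the \<open>j\<close>-th column, so it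
  is 0 for every \<open>j\<close> greater than the first part of the partition.
\<close>

definition conjugate :: "(nat \<Rightarrow> nat) \<Rightarrow> nat \<Rightarrow> nat" where
  "conjugate \<mu> j = card {i. (i, j) \<in> ferrers \<mu>}"

text \<open>
  The lists below are the index sequences \<open>i\<^sub>1 < \<dots> < i\<^sub>k\<close> in
  \<open>{1..n}\<close>, with \<open>i\<^sub>r\<close> stored at list position \<open>r - 1\<close>.
\<close>

definition e_star :: "nat \<Rightarrow> nat \<Rightarrow> (nat \<Rightarrow> int) \<Rightarrow> int" where
  "e_star n k x =
     (\<Sum>is | length is = k \<and> sorted_wrt (<) is \<and> set is \<subseteq> {1..n}.
        \<Prod>r=1..k. x (is ! (r - 1)) + int k - int r)"

definition horizontal_strips :: "(nat \<Rightarrow> nat) \<Rightarrow> nat \<Rightarrow> (nat \<times> nat) set set" where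
  "horizontal_strips \<mu> k =
     {S. S \<subseteq> ferrers \<mu> \<and> finite S \<and> card S = k \<and>
         (\<forall>c\<in>S. \<forall>d\<in>S. c \<noteq> d \<longrightarrow> snd c \<noteq> snd d)}"

definition horizontal_components :: "(nat \<times> nat) set \<Rightarrow> (nat \<times> nat) set set" where
  "horizontal_components S = (\<lambda>i. {c \<in> S. fst c = i}) ` fst ` S"

definition hstrip_fact :: "(nat \<times> nat) set \<Rightarrow> nat" where
  "hstrip_fact S = (\<Prod>H\<in>horizontal_components S. fact (card H))"

end

theory Submission
  imports Defs "HOL-Library.FuncSet"
begin

text \<open>
  Fix the columns \<open>i\<^sub>1 < \<dots> < i\<^sub>k\<close> occupied by a strip and insert its cells starting from the
  shortest column. Inserting a cell in row \<open>i\<close> multiplies the product of factorials by one plus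
  the number of cells already in row \<open>i\<close>. As all earlier cells lie in rows which meet the new
  column \<open>i\<^sub>r\<close>, the sum of these factors over the rows of that column is its length plus the
  number \<open>k - r\<close> of earlier cells.
\<close>

text \<open>Prescribing the occupied columns splits the sum over strips along the summands of
  \<open>e_star\<close>. Injectivity of \<open>snd\<close> is the condition of at most one cell per
  column.\<close>

definition column_strips :: "(nat \<Rightarrow> nat) \<Rightarrow> nat set \<Rightarrow> (nat \<times> nat) set set" where
  "column_strips \<mu> C = {S. S \<subseteq> ferrers \<mu> \<and> inj_on snd S \<and> snd ` S = C}"

lemma finite_ferrers:
  assumes "is_partition \<mu>"
  shows "finite (ferrers \<mu>)"
proof (rule finite_subset)
  have "\<mu> i \<le> \<mu> 1" if "1 \<le> i" for i
    using assms that by (simp add: is_partition_def)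
  then show "ferrers \<mu> \<subseteq> {i. 1 \<le> i \<and> \<mu> i \<noteq> 0} \<times> {..\<mu> 1}"
    by (auto simp: ferrers_def dest: order_trans)
  show "finite ({i. 1 \<le> i \<and> \<mu> i \<noteq> 0} \<times> {..\<mu> 1})"
    using assms by (simp add: is_partition_def)
qed

text \<open>As the parts weakly decrease, a column contains every positive row index below one of
  its own. Being finite, it is thus an initial segment of the positive integers.\<close>

lemma ferrers_column:
  assumes p: "is_partition \<mu>"
  shows "{i. (i, j) \<in> ferrers \<mu>} = {1..conjugate \<mu> j}"
proof -
  let ?A = "{i. (i, j) \<in> ferrers \<mu>}"
  have fin: "finite ?A"
    by (rule finite_subset[OF _ finite_imageI[OF finite_ferrers[OF p], of fst]]) force
  have down: "i' \<in> ?A" if "i \<in> ?A" "1 \<le> i'" "i' \<le> i" for i i'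
    using that p by (auto simp: ferrers_def is_partition_def intro: order_trans)
  \<comment> \<open>The inserted 0 gives an empty column the maximum 0, which makes the interval
    empty too.\<close>
  have "?A = {1..Max (insert 0 ?A)}"
  proof (intro set_eqI iffI)
    fix i assume "i \<in> ?A"
    then show "i \<in> {1..Max (insert 0 ?A)}"
      using fin by (auto simp: ferrers_def)
  next
    fix i assume i: "i \<in> {1..Max (insert 0 ?A)}"
    have "Max (insert 0 ?A) \<in> insert 0 ?A"
      using fin by (intro Max_in) auto
    then have "Max (insert 0 ?A) \<in> ?A" using i by auto
    then show "i \<in> ?A" using down i by auto
  qed
  then show ?thesis
    by (metis card_atLeastAtMost conjugate_def diff_Suc_1)
qed

lemma mem_ferrers_iff:
  assumes "is_partition \<mu>"
  shows "(i, j) \<in> ferrers \<mu> \<longleftrightarrow> 1 \<le> i \<and> i \<le> conjugate \<mu> j"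
  using ferrers_column[OF assms, of j] by (simp add: set_eq_iff)

text \<open>The row of the last cell of a nonempty column \<open>j'\<close> also meets column
  \<open>j\<close>, further left.\<close>

lemma conjugate_antimono:
  assumes "is_partition \<mu>" "1 \<le> j" "j \<le> j'"
  shows "conjugate \<mu> j' \<le> conjugate \<mu> j"
proof (cases "conjugate \<mu> j' = 0")
  case False
  then have "(conjugate \<mu> j', j') \<in> ferrers \<mu>"
    using assms(1) by (simp add: mem_ferrers_iff)
  then have "(conjugate \<mu> j', j) \<in> ferrers \<mu>"
    using assms(2,3) by (auto simp: ferrers_def)
  then show ?thesis using assms(1) by (simp add: mem_ferrers_iff)
qed simp

text \<open>Different occupied rows give different components, and an empty row contributes 0! = 1.
  This allows one index set for strips that occupy different rows.\<close>

lemma hstrip_fact_eq_prod_rows: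
  assumes "finite I" "fst ` S \<subseteq> I"
  shows "hstrip_fact S = (\<Prod>i\<in>I. fact (card {c \<in> S. fst c = i}))"
proof -
  have "inj_on (\<lambda>i. {c \<in> S. fst c = i}) (fst ` S)"
    by (rule inj_onI) auto
  then have "hstrip_fact S = (\<Prod>i\<in>fst ` S. fact (card {c \<in> S. fst c = i}))"
    by (simp add: hstrip_fact_def horizontal_components_def prod.reindex)
  also have "\<dots> = (\<Prod>i\<in>I. fact (card {c \<in> S. fst c = i}))"
  proof (rule prod.mono_neutral_left[OF assms], rule ballI)
    fix i assume "i \<in> I - fst ` S"
    then have "{c \<in> S. fst c = i} = {}" by force
    then show "fact (card {c \<in> S. fst c = i}) = 1" by (simp only: card.empty fact_0)
  qed
  finally show ?thesis .
qed

text \<open>Only the row of \<open>c\<close> changes: with m cells there before, its factor m!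
  becomes (m+1)! = (m+1) m!.\<close>

lemma hstrip_fact_insert:
  assumes "finite S" "c \<notin> S"
  shows "hstrip_fact (insert c S) = Suc (card {d \<in> S. fst d = fst c}) * hstrip_fact S"
proof -
  let ?I = "insert (fst c) (fst ` S)"
  have row: "{d \<in> insert c S. fst d = i} =
      (if i = fst c then insert c {d \<in> S. fst d = i} else {d \<in> S. fst d = i})" for i
    by auto
  have "hstrip_fact (insert c S) = (\<Prod>i\<in>?I. fact (card {d \<in> insert c S. fst d = i}))"
    using assms by (intro hstrip_fact_eq_prod_rows) auto
  also have "\<dots> = (\<Prod>i\<in>?I. (if i = fst c then Suc (card {d \<in> S. fst d = fst c}) else 1) *
      fact (card {d \<in> S. fst d = i}))"
    unfolding row using assms by (intro prod.cong) auto
  also have "\<dots> = Suc (card {d \<in> S. fst d = fst c}) * (\<Prod>i\<in>?I. fact (card {d \<in> S. fst d = i}))"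
    unfolding prod.distrib using assms by (subst prod.delta) auto
  also have "(\<Prod>i\<in>?I. fact (card {d \<in> S. fst d = i})) = hstrip_fact S"
    using assms by (intro hstrip_fact_eq_prod_rows[symmetric]) auto
  finally show ?thesis .
qed

text \<open>The inverse removes the cell in column \<open>a\<close> and records its row, which
  \<open>THE\<close> determines because \<open>snd\<close> is injective on a strip.\<close>

lemma column_strips_insert:
  assumes "a \<notin> C"
  shows "bij_betw (\<lambda>(S, i). insert (i, a) S)
    (column_strips \<mu> C \<times> {i. (i, a) \<in> ferrers \<mu>}) (column_strips \<mu> (insert a C))"
proof (rule bij_betwI[where g = "\<lambda>S. ({c \<in> S. snd c \<noteq> a}, THE i. (i, a) \<in> S)"])
  show "(\<lambda>(S, i). insert (i, a) S) \<in> column_strips \<mu> C \<times> {i. (i, a) \<in> ferrers \<mu>} \<rightarrow>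
      column_strips \<mu> (insert a C)"
    using assms by (force simp: column_strips_def)
next
  have the: "(THE i. (i, a) \<in> S) = i" if "inj_on snd S" "(i, a) \<in> S" for S :: "(nat \<times> nat) set" and i
    using that inj_onD[OF that(1) _ _ that(2)] by (intro the_equality) fastforce+
  show "(\<lambda>S. ({c \<in> S. snd c \<noteq> a}, THE i. (i, a) \<in> S)) \<in> column_strips \<mu> (insert a C) \<rightarrow>
      column_strips \<mu> C \<times> {i. (i, a) \<in> ferrers \<mu>}"
  proof
    fix S assume "S \<in> column_strips \<mu> (insert a C)"
    then have S: "S \<subseteq> ferrers \<mu>" "inj_on snd S" "snd ` S = insert a C"
      by (auto simp: column_strips_def)
    then obtain i where i: "(i, a) \<in> S" by force
    have "snd ` {c \<in> S. snd c \<noteq> a} = snd ` S - {a}" by auto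
    then have "{c \<in> S. snd c \<noteq> a} \<in> column_strips \<mu> C"
      using S assms by (auto simp: column_strips_def intro: inj_on_subset)
    then show "({c \<in> S. snd c \<noteq> a}, THE i. (i, a) \<in> S) \<in>
        column_strips \<mu> C \<times> {i. (i, a) \<in> ferrers \<mu>}"
      using the[OF S(2) i] S(1) i by auto
  qed
  show "(\<lambda>(S, i). insert (i, a) S) ({c \<in> S. snd c \<noteq> a}, THE i. (i, a) \<in> S) = S"
    if "S \<in> column_strips \<mu> (insert a C)" for S
  proof -
    have S: "inj_on snd S" "snd ` S = insert a C"
      using that by (auto simp: column_strips_def)
    then obtain i where i: "(i, a) \<in> S" by force
    have "c = (i, a)" if "c \<in> S" "snd c = a" for c
      using that inj_onD[OF S(1) _ _ i] by simp
    then have "insert (i, a) {c \<in> S. snd c \<noteq> a} = S"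
      using i by blast
    then show ?thesis by (simp only: the[OF S(1) i] prod.case)
  qed
  show "({c \<in> (\<lambda>(S, i). insert (i, a) S) p. snd c \<noteq> a},
      THE i. (i, a) \<in> (\<lambda>(S, i). insert (i, a) S) p) = p"
    if p: "p \<in> column_strips \<mu> C \<times> {i. (i, a) \<in> ferrers \<mu>}" for p
  proof -
    obtain S i where p_eq: "p = (S, i)" by (cases p)
    then have "inj_on snd S" and a: "a \<notin> snd ` S"
      using p assms by (auto simp: column_strips_def)
    then have "inj_on snd (insert (i, a) S)"
      by auto
    then have "(THE i'. (i', a) \<in> insert (i, a) S) = i"
      by (rule the) simp
    moreover have "{c \<in> insert (i, a) S. snd c \<noteq> a} = S"
      using a by auto
    ultimately show ?thesis
      unfolding p_eq by simp
  qed
qed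

lemma column_stripsD:
  assumes "S \<in> column_strips \<mu> C" "finite C"
  shows "finite S" "card S = card C"
  using assms by (auto simp: column_strips_def card_image intro: finite_imageD)

text \<open>Induction on \<open>js\<close>: the head is the smallest index, hence a longest column,
  and is filled last, after the strips on the tail.\<close>

lemma sum_hstrip_fact_column_strips:
  assumes p: "is_partition \<mu>"
    and "sorted_wrt (<) js" "\<forall>j\<in>set js. 1 \<le> j"
  shows "int (\<Sum>S\<in>column_strips \<mu> (set js). hstrip_fact S) =
    (\<Prod>r=1..length js. int (conjugate \<mu> (js ! (r - 1))) + int (length js) - int r)"
  using assms(2,3)
proof (induction js)
  case Nil
  have "column_strips \<mu> {} = {{}}" by (auto simp: column_strips_def)
  then show ?case by (simp add: hstrip_fact_def horizontal_components_def)
next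
  case (Cons a js)
  let ?m = "conjugate \<mu> a"
  have a: "a \<notin> set js" using Cons.prems(1) by auto
  have len: "card (set js) = length js"
    using Cons.prems(1) by (intro distinct_card) (simp add: strict_sorted_iff)
  have row_sum: "(\<Sum>i=1..?m. hstrip_fact (insert (i, a) S)) = (?m + length js) * hstrip_fact S"
    if S: "S \<in> column_strips \<mu> (set js)" for S
  proof -
    note fin = column_stripsD[OF S finite_set]
    \<comment> \<open>The columns of \<open>S\<close> lie to the right of \<open>a\<close>, so they
      are no longer than column \<open>a\<close>.\<close>
    have "fst c \<in> {1..?m}" if "c \<in> S" for c
    proof -
      have "(fst c, snd c) \<in> ferrers \<mu>" "snd c \<in> set js"
        using that S by (auto simp: column_strips_def)
      moreover from this have "conjugate \<mu> (snd c) \<le> ?m"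
        using Cons.prems by (intro conjugate_antimono[OF p]) (auto intro: less_imp_le)
      ultimately show ?thesis unfolding mem_ferrers_iff[OF p] by simp
    qed
    then have "fst ` S \<subseteq> {1..?m}" by (rule image_subsetI)
    \<comment> \<open>Counting the cells of \<open>S\<close> row by row loses none, since all their
      rows lie in \<open>{1..?m}\<close>.\<close>
    then have rows: "(\<Sum>i=1..?m. card {c \<in> S. fst c = i}) = card S"
      using sum.group[OF fin(1), of "{1..?m}" fst "\<lambda>_. 1::nat"] by simp
    have "(i, a) \<notin> S" for i
      using S a by (force simp: column_strips_def)
    then have "(\<Sum>i=1..?m. hstrip_fact (insert (i, a) S)) =
        (\<Sum>i=1..?m. Suc (card {c \<in> S. fst c = i}) * hstrip_fact S)"
      by (intro sum.cong) (simp_all add: hstrip_fact_insert[OF fin(1)])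
    also have "\<dots> = (\<Sum>i=1..?m. Suc (card {c \<in> S. fst c = i})) * hstrip_fact S"
      by (rule sum_distrib_right[symmetric])
    also have "\<dots> = (?m + length js) * hstrip_fact S"
      unfolding sum_Suc rows using fin(2) len by simp
    finally show ?thesis .
  qed
  have "(\<Sum>S\<in>column_strips \<mu> (set (a # js)). hstrip_fact S) =
      (\<Sum>(S, i)\<in>column_strips \<mu> (set js) \<times> {1..?m}. hstrip_fact (insert (i, a) S))"
    using sum.reindex_bij_betw[OF column_strips_insert[OF a, of \<mu>], of hstrip_fact]
    by (simp add: ferrers_column[OF p] case_prod_unfold)
  also have "\<dots> = (\<Sum>S\<in>column_strips \<mu> (set js). \<Sum>i=1..?m. hstrip_fact (insert (i, a) S))"
    by (rule sum.cartesian_product[symmetric])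
  also have "\<dots> = (?m + length js) * (\<Sum>S\<in>column_strips \<mu> (set js). hstrip_fact S)"
    unfolding sum_distrib_left by (rule sum.cong[OF refl row_sum])
  finally have "int (\<Sum>S\<in>column_strips \<mu> (set (a # js)). hstrip_fact S) =
      (int ?m + int (length js)) * int (\<Sum>S\<in>column_strips \<mu> (set js). hstrip_fact S)"
    by simp
  also have "\<dots> = (int ?m + int (length js)) *
      (\<Prod>r=1..length js. int (conjugate \<mu> (js ! (r - 1))) + int (length js) - int r)"
    using Cons by simp
  also have "\<dots> = (\<Prod>r=1..length (a # js).
      int (conjugate \<mu> ((a # js) ! (r - 1))) + int (length (a # js)) - int r)"
  proof -
    have shift: "(\<Prod>r=1..Suc l. g r) = g 1 * (\<Prod>r=1..l. g (Suc r))" for g :: "nat \<Rightarrow> int" and l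
      by (simp add: prod.atLeast_Suc_atMost prod.shift_bounds_cl_Suc_ivl del: prod.cl_ivl_Suc)
    \<comment> \<open>The factor \<open>r = 1\<close> is that of the head, with
      \<open>length (a # js) - 1 = length js\<close>. At \<open>Suc r\<close> the length and the
      position both grow by 1, which leaves the factor of \<open>js\<close> at
      \<open>r\<close>.\<close>
    show ?thesis
      unfolding length_Cons shift
      by (intro arg_cong2[of _ _ _ _ "(*)"] prod.cong) (simp_all add: nth_Cons')
  qed
  finally show ?case .
qed

theorem proposition4p18:
  fixes \<mu> :: "nat \<Rightarrow> nat" and n k :: nat
  assumes "is_partition \<mu>"
    and "\<mu> 1 \<le> n"
    and "1 \<le> k" and "k \<le> n"
  shows "e_star n k (\<lambda>i. int (conjugate \<mu> i)) = int (\<Sum>S\<in>horizontal_strips \<mu> k. hstrip_fact S)"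
proof -
  let ?L = "{js. length js = k \<and> sorted_wrt (<) js \<and> set js \<subseteq> {1..n}}"
  let ?H = "horizontal_strips \<mu> k"
  let ?cols = "\<lambda>S :: (nat \<times> nat) set. sorted_list_of_set (snd ` S)"
  have H: "S \<in> ?H \<longleftrightarrow> S \<subseteq> ferrers \<mu> \<and> finite S \<and> card S = k \<and> inj_on snd S" for S
    by (auto simp: horizontal_strips_def inj_on_def)
  have finH: "finite ?H"
    by (rule finite_subset[of _ "Pow (ferrers \<mu>)"])
      (auto simp: H finite_ferrers[OF assms(1)])
  have finL: "finite ?L"
    by (rule finite_subset[OF _ finite_lists_length_eq[of "{1..n}" k]]) auto
  \<comment> \<open>The bound on the first part enters here: no cell lies in a column beyond
    \<open>n\<close>.\<close>
  have cell_col: "snd c \<in> {1..n}" if c: "c \<in> ferrers \<mu>" for c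
  proof -
    have "1 \<le> fst c" "1 \<le> snd c" "snd c \<le> \<mu> (fst c)" using c by (auto simp: ferrers_def)
    moreover from this have "\<mu> (fst c) \<le> \<mu> 1" using assms(1) by (simp add: is_partition_def)
    ultimately show ?thesis using assms(2) by simp
  qed
  have cols: "?cols ` ?H \<subseteq> ?L"
    using cell_col by (fastforce simp: H card_image)
  \<comment> \<open>A strictly increasing list is the sorted list of its own entries, so
    \<open>?cols S = js\<close> only fixes the column set of \<open>S\<close>.\<close>
  have fibre: "{S \<in> ?H. ?cols S = js} = column_strips \<mu> (set js)" if js: "js \<in> ?L" for js
  proof (intro set_eqI iffI)
    fix S assume "S \<in> {S \<in> ?H. ?cols S = js}"
    then have "S \<subseteq> ferrers \<mu>" "finite S" "inj_on snd S" "js = ?cols S"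
      by (auto simp: H)
    then show "S \<in> column_strips \<mu> (set js)"
      by (simp add: column_strips_def)
  next
    fix S assume S: "S \<in> column_strips \<mu> (set js)"
    have "card (set js) = k"
      using js by (auto simp: strict_sorted_iff distinct_card)
    moreover have "?cols S = js"
      using S js by (auto simp: column_strips_def strict_sorted_iff sorted_list_of_set.idem_if_sorted_distinct)
    ultimately show "S \<in> {S \<in> ?H. ?cols S = js}"
      using S column_stripsD[OF S] by (auto simp: H column_strips_def)
  qed
  \<comment> \<open>The strips are grouped by their column lists. Lists with an index beyond the
    first part have an empty fibre, in accordance with their product: its factor
    \<open>r = k\<close> is 0 + k - k = 0.\<close>
  have "int (\<Sum>S\<in>?H. hstrip_fact S) = (\<Sum>js\<in>?L. int (\<Sum>S\<in>{S \<in> ?H. ?cols S = js}. hstrip_fact S))"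
    by (simp only: sum.group[OF finH finL cols, symmetric] of_nat_sum)
  also have "\<dots> = (\<Sum>js\<in>?L. \<Prod>r=1..k. int (conjugate \<mu> (js ! (r - 1))) + int k - int r)"
  proof (rule sum.cong[OF refl])
    fix js assume js: "js \<in> ?L"
    then have "sorted_wrt (<) js" "\<forall>j\<in>set js. 1 \<le> j" "length js = k" by auto
    then show "int (\<Sum>S\<in>{S \<in> ?H. ?cols S = js}. hstrip_fact S) =
        (\<Prod>r=1..k. int (conjugate \<mu> (js ! (r - 1))) + int k - int r)"
      unfolding fibre[OF js] using sum_hstrip_fact_column_strips[OF assms(1), of js] by simp
  qed
  finally show ?thesis by (simp add: e_star_def)
qed

end
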